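(* Let $G$ be a torsion Abelian group and let $F$ be the free commutative monoid on a set $Q$. Let $I:G\times G\to F$ be a map fulfilling the following conditions: (1) for all $a,b\in G$, $I(a,b)=I(b,a)$; (2) for all $a\in G$, $I(a,0)=0$; (3) for all $a,b,c\in G$, $I(a,b)+I(a+b,c)=I(b,c)+I(a,b+c)$; (4) if $a\in G\setminus\{0\}$, then $I(a,-a)\notin Q\cup\{0\}$. On $G\times F$ define the operation $(a,f)+_I(b,g)=(a+b,\ f+g+I(a,b))$. Then $G\times F$ with this binary operation is a reduced inside factorial monoid with basis $\{0\}\times Q$. Moreover, all elements in $\{0\}\times Q$ are irreducible, and $\mathrm{Ap}(G\times F,\{0\}\times Q)=G\times\{0\}$. If in addition (5) for every positive integer $n$, every $a\in G$ and every $f\in\mathrm{G}(F)$, $\sum_{i=1}^{n-1}I(a,ia)+nf\in F$ implies $f\in F$, then $G\times F$ is root-closed.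
   Context: Monoids are commutative, cancellative and written additively; $\mathbb{N}=\{0,1,2,\dots\}$. A monoid $M$ is reduced if its only unit is $0$. For a subset $Q\subseteq M$, $\langle Q\rangle$ denotes the submonoid generated by $Q$. A reduced monoid $M$ is inside factorial with base (Cale basis) $Q$, where $Q$ is a set of nonzero elements of $M$, if (i) for each $x\in M$ there is a positive integer $n(x)$ with $n(x)x\in\langle Q\rangle$, and (ii) whenever $\sum_{q\in Q}\lambda_q q=\sum_{q\in Q}\mu_q q$ with $\lambda_q,\mu_q\in\mathbb{N}$, all but finitely many zero, then $\lambda_q=\mu_q$ for all $q\in Q$. $\mathrm{G}(M)$ denotes the quotient group of $M$ (with $M\subseteq\mathrm{G}(M)$). $M$ is root-closed if whenever $nz\in M$ for some positive integer $n$ and some $z\in\mathrm{G}(M)$, then $z\in M$. The Apéry set of $M$ with respect to $Q$ is $\mathrm{Ap}(M,Q)=M\setminus(Q+M)$. An element of a reduced monoid is irreducible (an atom) if it is nonzero and is not the sum of two nonzero elements. The free commutative monoid on $Q$ is the monoid $\mathbb{N}^{(Q)}$ of finite formal sums of elements of $Q$ with coefficients in $\mathbb{N}$, with $Q$ identified with its basis. *)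

theory Defs
  imports "HOL-Algebra.Algebra" "HOL-Library.Multiset"
begin

(* Monoids and groups are HOL-Algebra structures, hence written multiplicatively:
   the additive notions 0, x + y, n x, -x appear as one, mult, power and inverse. *)

section \<open>Reduced and inside factorial monoids\<close>

locale reduced_monoid = comm_monoid_cancel M for M (structure) +
  assumes Units_trivial: "Units M = {\<one>}"

definition generated_submonoid :: "('a, 'b) monoid_scheme \<Rightarrow> 'a set \<Rightarrow> 'a set"
  where "generated_submonoid M Q = (\<lambda>H. submonoid H M) hull Q"

(* finprod over an infinite set is \<one>; the finiteness assumptions in base_unique
   make both products the intended finite ones. *)
locale inside_factorial = reduced_monoid M for M (structure) +
  fixes Q :: "'a set"
  assumes base_subset: "Q \<subseteq> carrier M - {\<one>}"
    and base_power: "x \<in> carrier M \<Longrightarrow> \<exists>n::nat. n > 0 \<and> x [^] n \<in> generated_submonoid M Q"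
    and base_unique:
      "\<And>l m :: 'a \<Rightarrow> nat.
        \<lbrakk>finite {q \<in> Q. l q \<noteq> 0}; finite {q \<in> Q. m q \<noteq> 0};
         (\<Otimes>q\<in>{q \<in> Q. l q \<noteq> 0}. q [^] l q) = (\<Otimes>q\<in>{q \<in> Q. m q \<noteq> 0}. q [^] m q)\<rbrakk>
        \<Longrightarrow> \<forall>q\<in>Q. l q = m q"

definition atom :: "('a, 'b) monoid_scheme \<Rightarrow> 'a \<Rightarrow> bool"
  where "atom M x \<longleftrightarrow>
    x \<in> carrier M \<and> x \<noteq> \<one>\<^bsub>M\<^esub> \<and>
    \<not> (\<exists>y\<in>carrier M - {\<one>\<^bsub>M\<^esub>}. \<exists>z\<in>carrier M - {\<one>\<^bsub>M\<^esub>}. x = y \<otimes>\<^bsub>M\<^esub> z)"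

definition apery_set :: "('a, 'b) monoid_scheme \<Rightarrow> 'a set \<Rightarrow> 'a set"
  where "apery_set M Q = carrier M - (Q <#>\<^bsub>M\<^esub> carrier M)"


section \<open>The quotient group of a commutative cancellative monoid\<close>

(* (x, y) stands for the formal difference of x and y. *)
definition diff_rel :: "('a, 'b) monoid_scheme \<Rightarrow> (('a \<times> 'a) \<times> ('a \<times> 'a)) set"
  where "diff_rel M =
    {((x, y), (x', y')). x \<in> carrier M \<and> y \<in> carrier M \<and> x' \<in> carrier M \<and> y' \<in> carrier M \<and>
       x \<otimes>\<^bsub>M\<^esub> y' = x' \<otimes>\<^bsub>M\<^esub> y}"

definition quotient_group :: "('a, 'b) monoid_scheme \<Rightarrow> ('a \<times> 'a) set monoid"
  where "quotient_group M =
    \<lparr>carrier = (carrier M \<times> carrier M) // diff_rel M,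
     monoid.mult = (\<lambda>A B. \<Union>(x, y)\<in>A. \<Union>(x', y')\<in>B. diff_rel M `` {(x \<otimes>\<^bsub>M\<^esub> x', y \<otimes>\<^bsub>M\<^esub> y')}),
     one = diff_rel M `` {(\<one>\<^bsub>M\<^esub>, \<one>\<^bsub>M\<^esub>)}\<rparr>"

definition quotient_embed :: "('a, 'b) monoid_scheme \<Rightarrow> 'a \<Rightarrow> ('a \<times> 'a) set"
  where "quotient_embed M x = diff_rel M `` {(x, \<one>\<^bsub>M\<^esub>)}"

definition root_closed :: "('a, 'b) monoid_scheme \<Rightarrow> bool"
  where "root_closed M \<longleftrightarrow>
    (\<forall>n::nat. \<forall>z\<in>carrier (quotient_group M).
       n > 0 \<longrightarrow> z [^]\<^bsub>quotient_group M\<^esub> n \<in> quotient_embed M ` carrier M \<longrightarrow>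
       z \<in> quotient_embed M ` carrier M)"

context comm_monoid_cancel
begin

lemma diff_rel_iff:
  "((x, y), (x', y')) \<in> diff_rel G \<longleftrightarrow>
     x \<in> carrier G \<and> y \<in> carrier G \<and> x' \<in> carrier G \<and> y' \<in> carrier G \<and> x \<otimes> y' = x' \<otimes> y"
  by (simp add: diff_rel_def)

lemma equiv_diff_rel: "equiv (carrier G \<times> carrier G) (diff_rel G)"
proof (rule equivI)
  show "diff_rel G \<subseteq> (carrier G \<times> carrier G) \<times> (carrier G \<times> carrier G)"
    by (auto simp: diff_rel_def)
  show "refl_on (carrier G \<times> carrier G) (diff_rel G)"
    by (auto simp: refl_on_def diff_rel_def)
  show "sym (diff_rel G)"
    by (auto simp: sym_def diff_rel_def)
  show "trans (diff_rel G)"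
  proof (rule transI, clarify)
    fix a b c d e f
    assume "((a, b), (c, d)) \<in> diff_rel G" "((c, d), (e, f)) \<in> diff_rel G"
    then have C: "a \<in> carrier G" "b \<in> carrier G" "c \<in> carrier G" "d \<in> carrier G"
        "e \<in> carrier G" "f \<in> carrier G" and 1: "a \<otimes> d = c \<otimes> b" and 2: "c \<otimes> f = e \<otimes> d"
      by (auto simp: diff_rel_iff)
    have "(a \<otimes> f) \<otimes> d = (a \<otimes> d) \<otimes> f" using C by (simp add: m_ac)
    also have "\<dots> = (c \<otimes> f) \<otimes> b" using C 1 by (simp add: m_ac)
    also have "\<dots> = (e \<otimes> b) \<otimes> d" using C 2 by (simp add: m_ac)
    finally have "a \<otimes> f = e \<otimes> b" using C r_cancel[of "a \<otimes> f" d "e \<otimes> b"] by simp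
    then show "((a, b), (e, f)) \<in> diff_rel G" using C by (simp add: diff_rel_iff)
  qed
qed

lemma quotient_group_carrierE:
  assumes "A \<in> carrier (quotient_group G)"
  obtains x y where "x \<in> carrier G" "y \<in> carrier G" "A = diff_rel G `` {(x, y)}"
  using assms by (auto simp: quotient_group_def elim!: quotientE)

lemma diff_class_closed:
  "\<lbrakk>x \<in> carrier G; y \<in> carrier G\<rbrakk> \<Longrightarrow> diff_rel G `` {(x, y)} \<in> carrier (quotient_group G)"
  by (auto simp: quotient_group_def intro: quotientI)

lemma diff_class_eq_iff:
  assumes "x \<in> carrier G" "y \<in> carrier G" "x' \<in> carrier G" "y' \<in> carrier G"
  shows "diff_rel G `` {(x, y)} = diff_rel G `` {(x', y')} \<longleftrightarrow> x \<otimes> y' = x' \<otimes> y"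
  using assms eq_equiv_class_iff[OF equiv_diff_rel, of "(x, y)" "(x', y')"]
  by (simp add: diff_rel_iff)

lemma quotient_group_mult:
  assumes "x \<in> carrier G" "y \<in> carrier G" "x' \<in> carrier G" "y' \<in> carrier G"
  shows "diff_rel G `` {(x, y)} \<otimes>\<^bsub>quotient_group G\<^esub> diff_rel G `` {(x', y')} =
    diff_rel G `` {(x \<otimes> x', y \<otimes> y')}" (is "?A \<otimes>\<^bsub>_\<^esub> ?B = ?C")
proof -
  have eq: "diff_rel G `` {(a \<otimes> a', b \<otimes> b')} = ?C"
    if "(a, b) \<in> ?A" "(a', b') \<in> ?B" for a b a' b'
  proof -
    have C: "a \<in> carrier G" "b \<in> carrier G" "a' \<in> carrier G" "b' \<in> carrier G"
      and 1: "x \<otimes> b = a \<otimes> y" and 2: "x' \<otimes> b' = a' \<otimes> y'"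
      using that by (auto simp: diff_rel_iff)
    have "(a \<otimes> a') \<otimes> (y \<otimes> y') = (a \<otimes> y) \<otimes> (a' \<otimes> y')" using C assms by (simp add: m_ac)
    also have "\<dots> = (x \<otimes> b) \<otimes> (x' \<otimes> b')" using 1 2 by simp
    also have "\<dots> = (x \<otimes> x') \<otimes> (b \<otimes> b')" using C assms by (simp add: m_ac)
    finally show ?thesis using C assms by (simp add: diff_class_eq_iff)
  qed
  have "(x, y) \<in> ?A" "(x', y') \<in> ?B"
    using assms by (simp_all add: diff_rel_iff)
  then have ne: "?A \<noteq> {}" "?B \<noteq> {}"
    by blast+
  have "?A \<otimes>\<^bsub>quotient_group G\<^esub> ?B =
      (\<Union>p\<in>?A. \<Union>p'\<in>?B. diff_rel G `` {(fst p \<otimes> fst p', snd p \<otimes> snd p')})"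
    by (simp add: quotient_group_def case_prod_unfold)
  also have "\<dots> = (\<Union>p\<in>?A. \<Union>p'\<in>?B. ?C)"
    by (intro SUP_cong refl eq) simp_all
  also have "\<dots> = ?C"
    using ne by simp
  finally show ?thesis .
qed

lemma quotient_group_one: "\<one>\<^bsub>quotient_group G\<^esub> = diff_rel G `` {(\<one>, \<one>)}"
  by (simp add: quotient_group_def)

lemma comm_group_quotient_group: "comm_group (quotient_group G)"
proof (rule comm_groupI)
  fix A B assume "A \<in> carrier (quotient_group G)" "B \<in> carrier (quotient_group G)"
  then show "A \<otimes>\<^bsub>quotient_group G\<^esub> B \<in> carrier (quotient_group G)"
    and "A \<otimes>\<^bsub>quotient_group G\<^esub> B = B \<otimes>\<^bsub>quotient_group G\<^esub> A"
    by (auto elim!: quotient_group_carrierE simp: quotient_group_mult diff_class_closed m_comm)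
next
  fix A B C assume "A \<in> carrier (quotient_group G)" "B \<in> carrier (quotient_group G)"
    "C \<in> carrier (quotient_group G)"
  then show "A \<otimes>\<^bsub>quotient_group G\<^esub> B \<otimes>\<^bsub>quotient_group G\<^esub> C =
      A \<otimes>\<^bsub>quotient_group G\<^esub> (B \<otimes>\<^bsub>quotient_group G\<^esub> C)"
    by (auto elim!: quotient_group_carrierE simp: quotient_group_mult m_assoc)
next
  show "\<one>\<^bsub>quotient_group G\<^esub> \<in> carrier (quotient_group G)"
    by (simp add: quotient_group_one diff_class_closed)
next
  fix A assume A: "A \<in> carrier (quotient_group G)"
  then show "\<one>\<^bsub>quotient_group G\<^esub> \<otimes>\<^bsub>quotient_group G\<^esub> A = A"
    by (auto elim!: quotient_group_carrierE simp: quotient_group_one quotient_group_mult)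
  obtain x y where xy: "x \<in> carrier G" "y \<in> carrier G" "A = diff_rel G `` {(x, y)}"
    using A by (rule quotient_group_carrierE)
  then have "diff_rel G `` {(y, x)} \<otimes>\<^bsub>quotient_group G\<^esub> A = \<one>\<^bsub>quotient_group G\<^esub>"
    by (simp add: quotient_group_one quotient_group_mult diff_class_eq_iff m_comm)
  then show "\<exists>B\<in>carrier (quotient_group G). B \<otimes>\<^bsub>quotient_group G\<^esub> A = \<one>\<^bsub>quotient_group G\<^esub>"
    using xy diff_class_closed by blast
qed

lemma quotient_embed_hom: "quotient_embed G \<in> hom G (quotient_group G)"
  by (auto simp: hom_def quotient_embed_def quotient_group_mult diff_class_closed)

lemma inj_on_quotient_embed: "inj_on (quotient_embed G) (carrier G)"
  by (auto simp: inj_on_def quotient_embed_def diff_class_eq_iff)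

end


section \<open>Free commutative monoids and the twisted product\<close>

(* Finite formal sums with coefficients in the naturals are finite multisets;
   the basis element q is {#q#}. *)
definition free_comm_monoid :: "'q set \<Rightarrow> 'q multiset monoid"
  where "free_comm_monoid Q = \<lparr>carrier = {f. set_mset f \<subseteq> Q}, monoid.mult = (+), one = {#}\<rparr>"

definition torsion_group :: "('a, 'b) monoid_scheme \<Rightarrow> bool"
  where "torsion_group G \<longleftrightarrow> group G \<and> (\<forall>a\<in>carrier G. \<exists>n::nat. n > 0 \<and> a [^]\<^bsub>G\<^esub> n = \<one>\<^bsub>G\<^esub>)"

definition twisted_product ::
  "('a, 'b) monoid_scheme \<Rightarrow> ('f, 'c) monoid_scheme \<Rightarrow> ('a \<Rightarrow> 'a \<Rightarrow> 'f) \<Rightarrow> ('a \<times> 'f) monoid"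
  where "twisted_product G F I =
    \<lparr>carrier = carrier G \<times> carrier F,
     monoid.mult = (\<lambda>(a, f) (b, g). (a \<otimes>\<^bsub>G\<^esub> b, f \<otimes>\<^bsub>F\<^esub> g \<otimes>\<^bsub>F\<^esub> I a b)),
     one = (\<one>\<^bsub>G\<^esub>, \<one>\<^bsub>F\<^esub>)\<rparr>"

end

theory Submission
  imports Defs
begin

text \<open>
  The twisted product of a group \<open>G\<close> and a monoid \<open>F\<close> is the usual extension of \<open>G\<close> by a
  symmetric normalised 2-cocycle \<open>I\<close>: the cocycle identity is associativity, symmetry is
  commutativity, normalisation provides the neutral element, and cancellation is inherited one
  component at a time.  The elements \<open>(1, f)\<close> form a copy of \<open>F\<close>, and the first component of a
  power \<open>(a, f)\<^sup>n\<close> is \<open>a\<^sup>n\<close>.  If \<open>G\<close> is torsion, every element therefore has a positive power in the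
  copy of \<open>F\<close>; when \<open>F\<close> is free on \<open>Q\<close>, this copy is generated by the basis and has unique
  representations, so the twisted product is inside factorial.

  A factorisation of \<open>(1, f)\<close> has the form \<open>(a, g) (a\<^sup>-\<^sup>1, h)\<close> with \<open>f = g h I(a, a\<^sup>-\<^sup>1)\<close>.  Hence
  \<open>I(a, a\<^sup>-\<^sup>1) \<noteq> 1\<close> for \<open>a \<noteq> 1\<close> makes the product reduced, and \<open>I(a, a\<^sup>-\<^sup>1) \<notin> Q\<close> makes the basis
  elements irreducible.  Multiplying by a basis element \<open>(1, q)\<close> produces no twist, so the multiples
  of basis elements are precisely the pairs whose second component is not empty.

  For root-closedness, the cocycle is pushed forward along the embedding of \<open>F\<close> in its quotient
  group \<open>G(F)\<close>.  The twisted product of \<open>G\<close> and \<open>G(F)\<close> contains that of \<open>G\<close> and \<open>F\<close>, and every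
  quotient \<open>x y\<^sup>-\<^sup>1\<close> is represented in it by some \<open>(c, u)\<close> with \<open>c \<in> G\<close> and \<open>u \<in> G(F)\<close>.  The second
  component of \<open>(c, u)\<^sup>n\<close> is \<open>u\<^sup>n\<close> times the product of the \<open>I(c, c\<^sup>i)\<close> for \<open>0 < i < n\<close>, so the root
  condition says precisely that \<open>(c, u)\<close> lies over \<open>F\<close> as soon as its \<open>n\<close>-th power does.
\<close>

section \<open>Homomorphisms and quotient groups\<close>

lemma hom_finprod_comm_monoid:
  assumes "comm_monoid M" "comm_monoid N" "h \<in> hom M N" "h \<one>\<^bsub>M\<^esub> = \<one>\<^bsub>N\<^esub>"
    and "f \<in> A \<rightarrow> carrier M"
  shows "h (finprod M f A) = finprod N (\<lambda>i. h (f i)) A"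
proof -
  interpret M: comm_monoid M by fact
  interpret N: comm_monoid N by fact
  have h_closed: "h x \<in> carrier N" if "x \<in> carrier M" for x
    using assms(3) that by (rule hom_in_carrier)
  show ?thesis
    using assms(5)
  proof (induction A rule: infinite_finite_induct)
    case (insert a A)
    then have "f a \<in> carrier M" "f \<in> A \<rightarrow> carrier M"
      by auto
    moreover from this have "(\<lambda>i. h (f i)) \<in> A \<rightarrow> carrier N"
      by (auto intro: h_closed)
    ultimately show ?case
      using insert hom_mult[OF assms(3)] by (simp add: h_closed)
  qed (simp_all add: assms(4))
qed

context comm_monoid_cancel
begin

lemma quotient_embed_closed:
  "x \<in> carrier G \<Longrightarrow> quotient_embed G x \<in> carrier (quotient_group G)"
  by (simp add: quotient_embed_def diff_class_closed)

lemma quotient_embed_mult: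
  "x \<in> carrier G \<Longrightarrow> y \<in> carrier G \<Longrightarrow>
    quotient_embed G (x \<otimes> y) = quotient_embed G x \<otimes>\<^bsub>quotient_group G\<^esub> quotient_embed G y"
  using quotient_embed_hom by (rule hom_mult)

lemma quotient_embed_one: "quotient_embed G \<one> = \<one>\<^bsub>quotient_group G\<^esub>"
  by (simp add: quotient_embed_def quotient_group_one)

lemma diff_class_pow:
  assumes "x \<in> carrier G" "y \<in> carrier G"
  shows "diff_rel G `` {(x, y)} [^]\<^bsub>quotient_group G\<^esub> (n::nat) = diff_rel G `` {(x [^] n, y [^] n)}"
  using assms by (induction n) (simp_all add: quotient_group_one quotient_group_mult)

text \<open>Writing an element of the quotient group as a fraction \<open>x y\<^sup>-\<^sup>1\<close> turns both membership
  conditions in the definition of root-closedness into equations inside the monoid.\<close>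

lemma root_closedI:
  assumes "\<And>(n::nat) x y w. \<lbrakk>n > 0; x \<in> carrier G; y \<in> carrier G; w \<in> carrier G;
      x [^] n = w \<otimes> y [^] n\<rbrakk> \<Longrightarrow> \<exists>v\<in>carrier G. x = v \<otimes> y"
  shows "root_closed G"
  unfolding root_closed_def
proof (intro allI ballI impI)
  fix n :: nat and z
  assume z: "z \<in> carrier (quotient_group G)" and n: "n > 0"
    and zn: "z [^]\<^bsub>quotient_group G\<^esub> n \<in> quotient_embed G ` carrier G"
  obtain x y where xy: "x \<in> carrier G" "y \<in> carrier G" and z_eq: "z = diff_rel G `` {(x, y)}"
    using z by (rule quotient_group_carrierE)
  obtain w where w: "w \<in> carrier G" "x [^] n = w \<otimes> y [^] n"
    using zn xy by (auto simp: z_eq diff_class_pow quotient_embed_def diff_class_eq_iff)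
  then obtain v where "v \<in> carrier G" "x = v \<otimes> y"
    using assms[OF n xy w] by blast
  then show "z \<in> quotient_embed G ` carrier G"
    using xy by (intro image_eqI[of _ _ v]) (simp_all add: z_eq quotient_embed_def diff_class_eq_iff)
qed

end


section \<open>Twisted products by symmetric cocycles\<close>

locale symmetric_cocycle = G: comm_group G + F: comm_monoid_cancel F
  for G :: "('a, 'b) monoid_scheme" and F :: "('f, 'c) monoid_scheme" +
  fixes I :: "'a \<Rightarrow> 'a \<Rightarrow> 'f"
  assumes cocycle_closed: "\<lbrakk>a \<in> carrier G; b \<in> carrier G\<rbrakk> \<Longrightarrow> I a b \<in> carrier F"
    and cocycle_sym: "\<lbrakk>a \<in> carrier G; b \<in> carrier G\<rbrakk> \<Longrightarrow> I a b = I b a"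
    and cocycle_one: "a \<in> carrier G \<Longrightarrow> I a \<one>\<^bsub>G\<^esub> = \<one>\<^bsub>F\<^esub>"
    and cocycle_assoc: "\<lbrakk>a \<in> carrier G; b \<in> carrier G; c \<in> carrier G\<rbrakk> \<Longrightarrow>
      I a b \<otimes>\<^bsub>F\<^esub> I (a \<otimes>\<^bsub>G\<^esub> b) c = I b c \<otimes>\<^bsub>F\<^esub> I a (b \<otimes>\<^bsub>G\<^esub> c)"
begin

abbreviation twisted :: "('a \<times> 'f) monoid"
  where "twisted \<equiv> twisted_product G F I"

lemma carrier_twisted: "carrier twisted = carrier G \<times> carrier F"
  by (simp add: twisted_product_def)

lemma one_twisted: "\<one>\<^bsub>twisted\<^esub> = (\<one>\<^bsub>G\<^esub>, \<one>\<^bsub>F\<^esub>)"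
  by (simp add: twisted_product_def)

lemma mult_twisted:
  "(a, f) \<otimes>\<^bsub>twisted\<^esub> (b, g) = (a \<otimes>\<^bsub>G\<^esub> b, f \<otimes>\<^bsub>F\<^esub> g \<otimes>\<^bsub>F\<^esub> I a b)"
  by (simp add: twisted_product_def)

lemma cocycle_one_left: "a \<in> carrier G \<Longrightarrow> I \<one>\<^bsub>G\<^esub> a = \<one>\<^bsub>F\<^esub>"
  using cocycle_sym[of a "\<one>\<^bsub>G\<^esub>"] cocycle_one by simp

lemma comm_monoid_cancel_twisted: "comm_monoid_cancel twisted"
proof (rule comm_monoid_cancelI)
  show "comm_monoid twisted"
  proof (rule comm_monoidI)
    fix x y z assume "x \<in> carrier twisted" "y \<in> carrier twisted" "z \<in> carrier twisted"
    then obtain a f b g c h where xyz: "x = (a, f)" "y = (b, g)" "z = (c, h)"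
      and C: "a \<in> carrier G" "b \<in> carrier G" "c \<in> carrier G"
        "f \<in> carrier F" "g \<in> carrier F" "h \<in> carrier F"
      by (auto simp: carrier_twisted)
    have I: "I a b \<in> carrier F" "I (a \<otimes>\<^bsub>G\<^esub> b) c \<in> carrier F" "I b c \<in> carrier F"
      "I a (b \<otimes>\<^bsub>G\<^esub> c) \<in> carrier F"
      using C by (simp_all add: cocycle_closed)
    have "f \<otimes>\<^bsub>F\<^esub> g \<otimes>\<^bsub>F\<^esub> I a b \<otimes>\<^bsub>F\<^esub> h \<otimes>\<^bsub>F\<^esub> I (a \<otimes>\<^bsub>G\<^esub> b) c =
        (f \<otimes>\<^bsub>F\<^esub> g \<otimes>\<^bsub>F\<^esub> h) \<otimes>\<^bsub>F\<^esub> (I a b \<otimes>\<^bsub>F\<^esub> I (a \<otimes>\<^bsub>G\<^esub> b) c)"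
      using C I by (simp add: F.m_ac)
    also have "\<dots> = (f \<otimes>\<^bsub>F\<^esub> g \<otimes>\<^bsub>F\<^esub> h) \<otimes>\<^bsub>F\<^esub> (I b c \<otimes>\<^bsub>F\<^esub> I a (b \<otimes>\<^bsub>G\<^esub> c))"
      using C by (simp add: cocycle_assoc)
    also have "\<dots> = f \<otimes>\<^bsub>F\<^esub> (g \<otimes>\<^bsub>F\<^esub> h \<otimes>\<^bsub>F\<^esub> I b c) \<otimes>\<^bsub>F\<^esub> I a (b \<otimes>\<^bsub>G\<^esub> c)"
      using C I by (simp add: F.m_ac)
    finally show "x \<otimes>\<^bsub>twisted\<^esub> y \<otimes>\<^bsub>twisted\<^esub> z = x \<otimes>\<^bsub>twisted\<^esub> (y \<otimes>\<^bsub>twisted\<^esub> z)"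
      using C by (simp add: xyz mult_twisted G.m_assoc)
  qed (auto simp: carrier_twisted one_twisted mult_twisted cocycle_closed cocycle_one
        cocycle_one_left G.m_comm F.m_comm cocycle_sym)
next
  fix x y z assume "x \<otimes>\<^bsub>twisted\<^esub> z = y \<otimes>\<^bsub>twisted\<^esub> z"
    "x \<in> carrier twisted" "y \<in> carrier twisted" "z \<in> carrier twisted"
  moreover from this obtain a f b g c h where xyz: "x = (a, f)" "y = (b, g)" "z = (c, h)"
    and C: "a \<in> carrier G" "b \<in> carrier G" "c \<in> carrier G"
      "f \<in> carrier F" "g \<in> carrier F" "h \<in> carrier F"
    by (auto simp: carrier_twisted)
  ultimately have "a \<otimes>\<^bsub>G\<^esub> c = b \<otimes>\<^bsub>G\<^esub> c \<and>
      f \<otimes>\<^bsub>F\<^esub> h \<otimes>\<^bsub>F\<^esub> I a c = g \<otimes>\<^bsub>F\<^esub> h \<otimes>\<^bsub>F\<^esub> I b c"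
    by (simp only: mult_twisted prod.inject)
  then have "a = b" and fg: "f \<otimes>\<^bsub>F\<^esub> h \<otimes>\<^bsub>F\<^esub> I b c = g \<otimes>\<^bsub>F\<^esub> h \<otimes>\<^bsub>F\<^esub> I b c"
    using C by auto
  have "f \<otimes>\<^bsub>F\<^esub> h = g \<otimes>\<^bsub>F\<^esub> h"
    by (rule F.r_cancel[OF fg]) (use C in \<open>simp_all add: cocycle_closed\<close>)
  then have "f = g"
    by (rule F.r_cancel) (use C in simp_all)
  then show "x = y"
    by (simp add: xyz \<open>a = b\<close>)
qed

sublocale T: comm_monoid_cancel twisted
  by (rule comm_monoid_cancel_twisted)

text \<open>The \<open>n\<close>-th power accumulates one twist \<open>I(a, a\<^sup>i)\<close> for each of the \<open>n - 1\<close> multiplications.\<close>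

lemma pow_twisted:
  assumes "a \<in> carrier G" "f \<in> carrier F"
  shows "(a, f) [^]\<^bsub>twisted\<^esub> (n::nat) =
    (a [^]\<^bsub>G\<^esub> n, (\<Otimes>\<^bsub>F\<^esub>i\<in>{1..n - 1}. I a (a [^]\<^bsub>G\<^esub> i)) \<otimes>\<^bsub>F\<^esub> f [^]\<^bsub>F\<^esub> n)"
proof (induction n)
  case 0
  then show ?case
    by (simp add: one_twisted)
next
  case (Suc n)
  let ?P = "\<lambda>n. \<Otimes>\<^bsub>F\<^esub>i\<in>{1..n - 1}. I a (a [^]\<^bsub>G\<^esub> i)"
  have P: "?P k \<in> carrier F" for k :: nat
    using assms by (auto intro!: F.finprod_closed cocycle_closed)
  have I: "I a (a [^]\<^bsub>G\<^esub> k) \<in> carrier F" for k :: nat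
    using assms by (simp add: cocycle_closed)
  have P_Suc: "?P (Suc n) = I a (a [^]\<^bsub>G\<^esub> n) \<otimes>\<^bsub>F\<^esub> ?P n"
  proof (cases n)
    case 0
    \<comment> \<open>The product is empty on both sides, and the additional twist is \<open>I(a, 1)\<close>.\<close>
    then show ?thesis
      using assms by (simp add: cocycle_one)
  next
    case (Suc m)
    then show ?thesis
      using I by (simp add: atLeastAtMostSuc_conv Pi_def del: nat_pow_Suc G.nat_pow_Suc)
  qed
  have "?P n \<otimes>\<^bsub>F\<^esub> f [^]\<^bsub>F\<^esub> n \<otimes>\<^bsub>F\<^esub> f \<otimes>\<^bsub>F\<^esub> I a (a [^]\<^bsub>G\<^esub> n) =
      ?P (Suc n) \<otimes>\<^bsub>F\<^esub> f [^]\<^bsub>F\<^esub> Suc n"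
    using assms P[of n] I[of n] unfolding P_Suc by (simp add: F.m_ac)
  then show ?case
    using Suc.IH assms cocycle_sym[of a "a [^]\<^bsub>G\<^esub> n"] by (simp add: mult_twisted)
qed

text \<open>If \<open>(a, f) (b, g) = 1\<close>, then \<open>b = a\<^sup>-\<^sup>1\<close> and the product of \<open>f\<close>, \<open>g\<close> and \<open>I(a, a\<^sup>-\<^sup>1)\<close> is
  trivial, so each of these factors is a unit of \<open>F\<close>.\<close>

lemma reduced_monoid_twisted:
  assumes F_units: "Units F = {\<one>\<^bsub>F\<^esub>}"
    and nontrivial: "\<And>a. \<lbrakk>a \<in> carrier G; a \<noteq> \<one>\<^bsub>G\<^esub>\<rbrakk> \<Longrightarrow> I a (inv\<^bsub>G\<^esub> a) \<noteq> \<one>\<^bsub>F\<^esub>"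
  shows "reduced_monoid twisted"
proof unfold_locales
  have "x = \<one>\<^bsub>twisted\<^esub>" if x: "x \<in> Units twisted" for x
  proof -
    obtain y where xy: "x \<in> carrier twisted" "y \<in> carrier twisted" "x \<otimes>\<^bsub>twisted\<^esub> y = \<one>\<^bsub>twisted\<^esub>"
      using x by (auto simp: Units_def)
    then obtain a f b g where x_eq: "x = (a, f)" and y_eq: "y = (b, g)"
      and C: "a \<in> carrier G" "b \<in> carrier G" "f \<in> carrier F" "g \<in> carrier F"
      by (auto simp: carrier_twisted)
    have ab: "a \<otimes>\<^bsub>G\<^esub> b = \<one>\<^bsub>G\<^esub>" and fg: "f \<otimes>\<^bsub>F\<^esub> g \<otimes>\<^bsub>F\<^esub> I a b = \<one>\<^bsub>F\<^esub>"
      using xy by (simp_all add: x_eq y_eq mult_twisted one_twisted)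
    have b: "b = inv\<^bsub>G\<^esub> a"
      using ab C G.m_comm by (metis G.inv_equality)
    have I: "I a b \<in> carrier F"
      using C by (simp add: cocycle_closed)
    have unit_one: "u = \<one>\<^bsub>F\<^esub>" if "u \<in> carrier F" "v \<in> carrier F" "u \<otimes>\<^bsub>F\<^esub> v = \<one>\<^bsub>F\<^esub>" for u v
      using that F_units F.m_comm[of u v] by (auto simp: Units_def)
    have "f = \<one>\<^bsub>F\<^esub>"
      using unit_one[of f "g \<otimes>\<^bsub>F\<^esub> I a b"] fg C I by (simp add: F.m_assoc)
    moreover have "I a b = \<one>\<^bsub>F\<^esub>"
      using unit_one[of "I a b" "f \<otimes>\<^bsub>F\<^esub> g"] fg C I by (simp add: F.m_comm)
    ultimately show ?thesis
      using nontrivial C by (auto simp: x_eq b one_twisted)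
  qed
  then show "Units twisted = {\<one>\<^bsub>twisted\<^esub>}"
    by auto
qed

text \<open>Pushing the cocycle forward to the quotient group of \<open>F\<close> makes division possible in the
  second component.\<close>

lemma symmetric_cocycle_quotient:
  "symmetric_cocycle G (quotient_group F) (\<lambda>a b. quotient_embed F (I a b))"
proof -
  interpret K: comm_group "quotient_group F"
    by (rule F.comm_group_quotient_group)
  show ?thesis
  proof unfold_locales
    show "quotient_embed F (I a b) = quotient_embed F (I b a)"
      if "a \<in> carrier G" "b \<in> carrier G" for a b
      using that by (simp add: cocycle_sym[of a b])
  qed (simp_all add: F.quotient_embed_closed cocycle_closed cocycle_one cocycle_assoc
        F.quotient_embed_one flip: F.quotient_embed_mult)
qed

text \<open>Since \<open>x\<^sup>n = w y\<^sup>n\<close>, the fraction \<open>x y\<^sup>-\<^sup>1 = (c, u)\<close> over \<open>G(F)\<close> satisfies \<open>(c, u)\<^sup>n = w\<close>.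
  Comparing second components with the power formula gives the hypothesis of the root condition for
  \<open>c\<close> and \<open>u\<close>, and the condition then places \<open>u\<close> in \<open>F\<close>.\<close>

theorem root_closed_twisted:
  assumes root: "\<And>(n::nat) a u. \<lbrakk>n > 0; a \<in> carrier G; u \<in> carrier (quotient_group F);
      quotient_embed F (\<Otimes>\<^bsub>F\<^esub>i\<in>{1..n - 1}. I a (a [^]\<^bsub>G\<^esub> i)) \<otimes>\<^bsub>quotient_group F\<^esub>
        u [^]\<^bsub>quotient_group F\<^esub> n \<in> quotient_embed F ` carrier F\<rbrakk>
    \<Longrightarrow> u \<in> quotient_embed F ` carrier F"
  shows "root_closed twisted"
proof (rule T.root_closedI)
  let ?K = "quotient_group F" and ?e = "quotient_embed F"
  interpret K: comm_group ?K
    by (rule F.comm_group_quotient_group)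
  interpret L: symmetric_cocycle G ?K "\<lambda>a b. ?e (I a b)"
    by (rule symmetric_cocycle_quotient)
  let ?L = "L.twisted"
  let ?j = "\<lambda>(a, f). (a, ?e f)"
  have j_hom: "?j \<in> hom twisted ?L"
    by (auto simp: hom_def carrier_twisted L.carrier_twisted mult_twisted L.mult_twisted
        F.quotient_embed_closed F.quotient_embed_mult cocycle_closed)
  have j_closed: "?j x \<in> carrier ?L" if "x \<in> carrier twisted" for x
    using j_hom that by (rule hom_in_carrier)
  have j_mult: "?j (x \<otimes>\<^bsub>twisted\<^esub> y) = ?j x \<otimes>\<^bsub>?L\<^esub> ?j y"
    if "x \<in> carrier twisted" "y \<in> carrier twisted" for x y
    using j_hom that by (rule hom_mult)
  have j_pow: "?j (x [^]\<^bsub>twisted\<^esub> n) = ?j x [^]\<^bsub>?L\<^esub> n" if "x \<in> carrier twisted" for x and n :: nat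
  proof (induction n)
    case 0
    show ?case
      by (simp add: one_twisted L.one_twisted F.quotient_embed_one)
  next
    case (Suc n)
    then show ?case
      using that by (simp only: nat_pow_Suc j_mult T.nat_pow_closed)
  qed
  have j_inj: "inj_on ?j (carrier twisted)"
    using F.inj_on_quotient_embed by (auto simp: inj_on_def carrier_twisted)

  fix n :: nat and x y w
  assume n: "n > 0" and x: "x \<in> carrier twisted" and y: "y \<in> carrier twisted"
    and w: "w \<in> carrier twisted" and xw: "x [^]\<^bsub>twisted\<^esub> n = w \<otimes>\<^bsub>twisted\<^esub> y [^]\<^bsub>twisted\<^esub> n"
  obtain a f b g where x_eq: "x = (a, f)" and y_eq: "y = (b, g)"
    and C: "a \<in> carrier G" "b \<in> carrier G" "f \<in> carrier F" "g \<in> carrier F"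
    using x y by (auto simp: carrier_twisted)
  \<comment> \<open>The pair \<open>(c, u)\<close> is the fraction \<open>x y\<^sup>-\<^sup>1\<close>, computed over the quotient group of \<open>F\<close>.\<close>
  define c where "c = a \<otimes>\<^bsub>G\<^esub> inv\<^bsub>G\<^esub> b"
  define d where "d = ?e g \<otimes>\<^bsub>?K\<^esub> ?e (I c b)"
  define u where "u = ?e f \<otimes>\<^bsub>?K\<^esub> inv\<^bsub>?K\<^esub> d"
  have c: "c \<in> carrier G" and c_mult: "c \<otimes>\<^bsub>G\<^esub> b = a"
    using C by (simp_all add: c_def G.m_assoc)
  have I: "?e (I c b) \<in> carrier ?K" and e: "?e f \<in> carrier ?K" "?e g \<in> carrier ?K"
    using C c by (simp_all add: F.quotient_embed_closed cocycle_closed)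
  have d: "d \<in> carrier ?K" and u: "u \<in> carrier ?K"
    using I e by (simp_all add: d_def u_def)
  have "u \<otimes>\<^bsub>?K\<^esub> d = ?e f"
    using d e by (simp add: u_def K.m_assoc)
  then have cu: "(c, u) \<otimes>\<^bsub>?L\<^esub> ?j y = ?j x"
    using I e u by (simp add: x_eq y_eq L.mult_twisted c_mult d_def K.m_assoc)
  have cu_closed: "(c, u) \<in> carrier ?L"
    using c u by (simp add: L.carrier_twisted)
  have "?j w \<otimes>\<^bsub>?L\<^esub> ?j y [^]\<^bsub>?L\<^esub> n = ?j (x [^]\<^bsub>twisted\<^esub> n)"
    using w y by (simp only: xw j_mult j_pow T.nat_pow_closed)
  also have "\<dots> = ((c, u) \<otimes>\<^bsub>?L\<^esub> ?j y) [^]\<^bsub>?L\<^esub> n"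
    using x by (simp only: j_pow cu)
  also have "\<dots> = (c, u) [^]\<^bsub>?L\<^esub> n \<otimes>\<^bsub>?L\<^esub> ?j y [^]\<^bsub>?L\<^esub> n"
    by (rule L.T.nat_pow_distrib[OF cu_closed j_closed[OF y]])
  finally have "?j w = (c, u) [^]\<^bsub>?L\<^esub> n"
    by (rule L.T.r_cancel)
      (intro j_closed w cu_closed L.T.nat_pow_closed y)+
  also have "\<dots> = (c [^]\<^bsub>G\<^esub> n,
      (\<Otimes>\<^bsub>?K\<^esub>i\<in>{1..n - 1}. ?e (I c (c [^]\<^bsub>G\<^esub> i))) \<otimes>\<^bsub>?K\<^esub> u [^]\<^bsub>?K\<^esub> n)"
    by (rule L.pow_twisted[OF c u])
  also have "(\<Otimes>\<^bsub>?K\<^esub>i\<in>{1..n - 1}. ?e (I c (c [^]\<^bsub>G\<^esub> i))) =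
      ?e (\<Otimes>\<^bsub>F\<^esub>i\<in>{1..n - 1}. I c (c [^]\<^bsub>G\<^esub> i))"
    using c
    by (intro hom_finprod_comm_monoid[symmetric] F.quotient_embed_hom F.quotient_embed_one
        F.comm_monoid_axioms K.comm_monoid_axioms) (auto intro: cocycle_closed)
  finally have "?e (\<Otimes>\<^bsub>F\<^esub>i\<in>{1..n - 1}. I c (c [^]\<^bsub>G\<^esub> i)) \<otimes>\<^bsub>?K\<^esub> u [^]\<^bsub>?K\<^esub> n \<in> ?e ` carrier F"
    using w by (auto simp: carrier_twisted)
  then obtain h where h: "h \<in> carrier F" "u = ?e h"
    using root[OF n c u] by blast
  have ch: "(c, h) \<in> carrier twisted"
    using c h by (simp add: carrier_twisted)
  have "?j ((c, h) \<otimes>\<^bsub>twisted\<^esub> y) = ?j x"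
    using cu by (simp only: j_mult[OF ch y] h(2) prod.case)
  then have "(c, h) \<otimes>\<^bsub>twisted\<^esub> y = x"
    using j_inj ch x y by (auto dest: inj_onD)
  with ch show "\<exists>v\<in>carrier twisted. x = v \<otimes>\<^bsub>twisted\<^esub> y"
    by blast
qed

end


section \<open>Cocycles with values in a free commutative monoid\<close>

lemma carrier_free: "carrier (free_comm_monoid Q) = {f. set_mset f \<subseteq> Q}"
  and mult_free: "f \<otimes>\<^bsub>free_comm_monoid Q\<^esub> g = f + g"
  and one_free: "\<one>\<^bsub>free_comm_monoid Q\<^esub> = {#}"
  by (simp_all add: free_comm_monoid_def)

lemma comm_monoid_cancel_free: "comm_monoid_cancel (free_comm_monoid Q)"
  by (rule comm_monoid_cancelI, rule comm_monoidI)
    (auto simp: carrier_free mult_free one_free)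

lemma Units_free: "Units (free_comm_monoid Q) = {\<one>\<^bsub>free_comm_monoid Q\<^esub>}"
  by (auto simp: Units_def carrier_free mult_free one_free)

lemma pow_free: "f [^]\<^bsub>free_comm_monoid Q\<^esub> (n::nat) = repeat_mset n f"
  by (induction n) (simp_all add: mult_free one_free)

locale free_cocycle = symmetric_cocycle G "free_comm_monoid Q" I
  for G :: "('a, 'b) monoid_scheme" and Q :: "'q set" and I
begin

abbreviation basis :: "('a \<times> 'q multiset) set"
  where "basis \<equiv> {\<one>\<^bsub>G\<^esub>} \<times> ((\<lambda>q. {#q#}) ` Q)"

lemma basis_subset: "basis \<subseteq> carrier twisted - {\<one>\<^bsub>twisted\<^esub>}"
  by (auto simp: carrier_twisted carrier_free one_twisted one_free)

lemma apery_set_twisted: "apery_set twisted basis = carrier G \<times> {{#}}"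
proof -
  have "basis <#>\<^bsub>twisted\<^esub> carrier twisted = {(a, f). a \<in> carrier G \<and> set_mset f \<subseteq> Q \<and> f \<noteq> {#}}"
  proof (intro equalityI subsetI)
    fix x assume "x \<in> basis <#>\<^bsub>twisted\<^esub> carrier twisted"
    then show "x \<in> {(a, f). a \<in> carrier G \<and> set_mset f \<subseteq> Q \<and> f \<noteq> {#}}"
      by (auto simp: set_mult_def carrier_twisted carrier_free mult_twisted mult_free one_free
          cocycle_one_left)
  next
    fix x assume "x \<in> {(a, f). a \<in> carrier G \<and> set_mset f \<subseteq> Q \<and> f \<noteq> {#}}"
    then obtain a g where g: "x = (a, g)" "a \<in> carrier G" "set_mset g \<subseteq> Q" "g \<noteq> {#}"
      by auto
    then obtain q f where "g = add_mset q f"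
      by (meson multi_nonempty_split)
    with g have x: "x = (a, add_mset q f)" and C: "a \<in> carrier G" "q \<in> Q" "set_mset f \<subseteq> Q"
      by auto
    then have "x = (\<one>\<^bsub>G\<^esub>, {#q#}) \<otimes>\<^bsub>twisted\<^esub> (a, f)"
      by (simp add: mult_twisted mult_free one_free cocycle_one_left)
    then show "x \<in> basis <#>\<^bsub>twisted\<^esub> carrier twisted"
      using C by (auto simp: set_mult_def carrier_twisted carrier_free)
  qed
  then show ?thesis
    by (auto simp: apery_set_def carrier_twisted carrier_free)
qed

text \<open>In a factorisation \<open>(1, q) = (a, f) (a\<^sup>-\<^sup>1, g)\<close> the twist \<open>I(a, a\<^sup>-\<^sup>1)\<close> is a summand of the
  single letter \<open>q\<close>; the hypothesis then leaves only \<open>a = 1\<close>, and one of \<open>f\<close>, \<open>g\<close> is empty.\<close>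

lemma basis_atom:
  assumes twist: "\<And>a. \<lbrakk>a \<in> carrier G; a \<noteq> \<one>\<^bsub>G\<^esub>\<rbrakk> \<Longrightarrow> I a (inv\<^bsub>G\<^esub> a) \<notin> (\<lambda>q. {#q#}) ` Q \<union> {{#}}"
    and x: "x \<in> basis"
  shows "atom twisted x"
proof -
  have "x \<in> carrier twisted - {\<one>\<^bsub>twisted\<^esub>}"
    using basis_subset x by (rule subsetD)
  moreover have False
    if "\<exists>y\<in>carrier twisted - {\<one>\<^bsub>twisted\<^esub>}. \<exists>z\<in>carrier twisted - {\<one>\<^bsub>twisted\<^esub>}.
      x = y \<otimes>\<^bsub>twisted\<^esub> z"
  proof -
    from that obtain a f b g where ne: "(a, f) \<noteq> \<one>\<^bsub>twisted\<^esub>" "(b, g) \<noteq> \<one>\<^bsub>twisted\<^esub>"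
      and C: "a \<in> carrier G" "b \<in> carrier G" and x_eq: "x = (a, f) \<otimes>\<^bsub>twisted\<^esub> (b, g)"
      by (auto simp: carrier_twisted)
    obtain q where q: "q \<in> Q" "x = (\<one>\<^bsub>G\<^esub>, {#q#})"
      using x by blast
    have ab: "a \<otimes>\<^bsub>G\<^esub> b = \<one>\<^bsub>G\<^esub>" and fg: "f + g + I a b = {#q#}"
      using x_eq q by (simp_all add: mult_twisted mult_free)
    have b: "b = inv\<^bsub>G\<^esub> a"
      using ab C G.m_comm by (metis G.inv_equality)
    have "I a b = {#q#} \<or> I a b = {#}"
      using fg by (auto simp: union_is_single)
    then have a: "a = \<one>\<^bsub>G\<^esub>"
      using twist[OF C(1)] q b by auto
    then have "f = {#} \<or> g = {#}"
      using fg C by (auto simp: union_is_single)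
    then show False
      using ne a b by (auto simp: one_twisted one_free)
  qed
  ultimately show ?thesis
    unfolding atom_def by blast
qed

lemma pow_untwisted:
  assumes "set_mset f \<subseteq> Q"
  shows "(\<one>\<^bsub>G\<^esub>, f) [^]\<^bsub>twisted\<^esub> (n::nat) = (\<one>\<^bsub>G\<^esub>, repeat_mset n f)"
  using assms
  by (simp add: pow_twisted carrier_free pow_free mult_free one_free cocycle_one
      F.finprod_one_eqI)

lemma untwisted_in_generated:
  assumes "set_mset f \<subseteq> Q"
  shows "(\<one>\<^bsub>G\<^esub>, f) \<in> generated_submonoid twisted basis"
  unfolding generated_submonoid_def hull_def
proof (rule InterI)
  fix H assume "H \<in> {H. submonoid H twisted \<and> basis \<subseteq> H}"
  then have H: "submonoid H twisted" and basis_H: "basis \<subseteq> H"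
    by auto
  show "(\<one>\<^bsub>G\<^esub>, f) \<in> H"
    using assms
  proof (induction f)
    case empty
    show ?case
      using submonoid.one_closed[OF H] by (simp add: one_twisted one_free)
  next
    case (add q f)
    then have "(\<one>\<^bsub>G\<^esub>, {#q#}) \<otimes>\<^bsub>twisted\<^esub> (\<one>\<^bsub>G\<^esub>, f) \<in> H"
      using basis_H by (intro submonoid.m_closed[OF H]) auto
    then show ?case
      by (simp add: mult_twisted mult_free one_free cocycle_one)
  qed
qed

text \<open>The multiplicities of the letters recover the exponents of a product of basis elements, which
  gives uniqueness of representations.\<close>

lemma finprod_basis:
  fixes l :: "'a \<times> 'q multiset \<Rightarrow> nat"
  assumes "finite A" "A \<subseteq> basis"
  shows "\<exists>f. (\<Otimes>\<^bsub>twisted\<^esub>x\<in>A. x [^]\<^bsub>twisted\<^esub> l x) = (\<one>\<^bsub>G\<^esub>, f) \<and>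
    (\<forall>q. count f q = (if (\<one>\<^bsub>G\<^esub>, {#q#}) \<in> A then l (\<one>\<^bsub>G\<^esub>, {#q#}) else 0))"
  using assms
proof (induction A rule: finite_induct)
  case empty
  show ?case
    by (simp add: one_twisted one_free)
next
  case (insert x A)
  then obtain f where f: "(\<Otimes>\<^bsub>twisted\<^esub>x\<in>A. x [^]\<^bsub>twisted\<^esub> l x) = (\<one>\<^bsub>G\<^esub>, f)"
    "\<And>q. count f q = (if (\<one>\<^bsub>G\<^esub>, {#q#}) \<in> A then l (\<one>\<^bsub>G\<^esub>, {#q#}) else 0)"
    by auto
  obtain p where p: "p \<in> Q" "x = (\<one>\<^bsub>G\<^esub>, {#p#})"
    using insert.prems by auto
  have "x \<in> carrier twisted" "A \<subseteq> carrier twisted"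
    using insert.prems basis_subset by blast+
  then have "(\<Otimes>\<^bsub>twisted\<^esub>x\<in>insert x A. x [^]\<^bsub>twisted\<^esub> l x) = x [^]\<^bsub>twisted\<^esub> l x \<otimes>\<^bsub>twisted\<^esub> (\<one>\<^bsub>G\<^esub>, f)"
    using insert.hyps f(1) by (subst T.finprod_insert) auto
  also have "\<dots> = (\<one>\<^bsub>G\<^esub>, repeat_mset (l x) {#p#} + f)"
    using p by (simp add: pow_untwisted mult_twisted mult_free one_free cocycle_one)
  finally show ?case
    using insert.hyps(2) p(2) by (auto simp: f(2))
qed

lemma inside_factorial_twisted:
  assumes reduced: "reduced_monoid twisted" and torsion: "torsion_group G"
  shows "inside_factorial twisted basis"
proof -
  interpret R: reduced_monoid twisted by (rule reduced)
  show ?thesis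
  proof unfold_locales
    show "basis \<subseteq> carrier twisted - {\<one>\<^bsub>twisted\<^esub>}"
      by (rule basis_subset)
  next
    fix x assume x: "x \<in> carrier twisted"
    then obtain a f where x_eq: "x = (a, f)" and a: "a \<in> carrier G"
      and f: "f \<in> carrier (free_comm_monoid Q)"
      by (auto simp: carrier_twisted)
    obtain n :: nat where n: "n > 0" "a [^]\<^bsub>G\<^esub> n = \<one>\<^bsub>G\<^esub>"
      using torsion a by (auto simp: torsion_group_def)
    obtain g where g: "x [^]\<^bsub>twisted\<^esub> n = (\<one>\<^bsub>G\<^esub>, g)"
      using n a f by (simp add: x_eq pow_twisted)
    have "set_mset g \<subseteq> Q"
      using T.nat_pow_closed[OF x, of n] by (simp add: g carrier_twisted carrier_free)
    then show "\<exists>n::nat. n > 0 \<and> x [^]\<^bsub>twisted\<^esub> n \<in> generated_submonoid twisted basis"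
      using n(1) g untwisted_in_generated by metis
  next
    fix l m :: "'a \<times> 'q multiset \<Rightarrow> nat"
    assume fin: "finite {x \<in> basis. l x \<noteq> 0}" "finite {x \<in> basis. m x \<noteq> 0}"
      and eq: "(\<Otimes>\<^bsub>twisted\<^esub>x\<in>{x \<in> basis. l x \<noteq> 0}. x [^]\<^bsub>twisted\<^esub> l x) =
        (\<Otimes>\<^bsub>twisted\<^esub>x\<in>{x \<in> basis. m x \<noteq> 0}. x [^]\<^bsub>twisted\<^esub> m x)"
    obtain f where f: "(\<Otimes>\<^bsub>twisted\<^esub>x\<in>{x \<in> basis. l x \<noteq> 0}. x [^]\<^bsub>twisted\<^esub> l x) = (\<one>\<^bsub>G\<^esub>, f)"
      "\<And>q. count f q =
        (if (\<one>\<^bsub>G\<^esub>, {#q#}) \<in> {x \<in> basis. l x \<noteq> 0} then l (\<one>\<^bsub>G\<^esub>, {#q#}) else 0)"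
      using finprod_basis[OF fin(1), of l] by blast
    obtain g where g: "(\<Otimes>\<^bsub>twisted\<^esub>x\<in>{x \<in> basis. m x \<noteq> 0}. x [^]\<^bsub>twisted\<^esub> m x) = (\<one>\<^bsub>G\<^esub>, g)"
      "\<And>q. count g q =
        (if (\<one>\<^bsub>G\<^esub>, {#q#}) \<in> {x \<in> basis. m x \<noteq> 0} then m (\<one>\<^bsub>G\<^esub>, {#q#}) else 0)"
      using finprod_basis[OF fin(2), of m] by blast
    have "f = g"
      using eq f(1) g(1) by simp
    show "\<forall>x\<in>basis. l x = m x"
    proof
      fix x assume x: "x \<in> basis"
      then obtain q where q: "x = (\<one>\<^bsub>G\<^esub>, {#q#})"
        by auto
      have "l x = count f q" "m x = count g q"
        using x unfolding f(2) g(2) q by auto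
      then show "l x = m x"
        using \<open>f = g\<close> by simp
    qed
  qed
qed

end

theorem theorem2:
  fixes G :: "('a, 'b) monoid_scheme"
    and Q :: "'q set"
    and F :: "'q multiset monoid"
    and I :: "'a \<Rightarrow> 'a \<Rightarrow> 'q multiset"
    and M :: "('a \<times> 'q multiset) monoid"
    and B :: "('a \<times> 'q multiset) set"
  assumes F: "F = free_comm_monoid Q"
    and M: "M = twisted_product G F I"
    and B: "B = {\<one>\<^bsub>G\<^esub>} \<times> ((\<lambda>q. {#q#}) ` Q)"
    and G: "comm_group G" "torsion_group G"
    and I: "\<forall>a\<in>carrier G. \<forall>b\<in>carrier G. I a b \<in> carrier F"
    and 1: "\<forall>a\<in>carrier G. \<forall>b\<in>carrier G. I a b = I b a"
    and 2: "\<forall>a\<in>carrier G. I a \<one>\<^bsub>G\<^esub> = \<one>\<^bsub>F\<^esub>"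
    and 3: "\<forall>a\<in>carrier G. \<forall>b\<in>carrier G. \<forall>c\<in>carrier G.
      I a b \<otimes>\<^bsub>F\<^esub> I (a \<otimes>\<^bsub>G\<^esub> b) c = I b c \<otimes>\<^bsub>F\<^esub> I a (b \<otimes>\<^bsub>G\<^esub> c)"
    and 4: "\<forall>a\<in>carrier G - {\<one>\<^bsub>G\<^esub>}. I a (inv\<^bsub>G\<^esub> a) \<notin> (\<lambda>q. {#q#}) ` Q \<union> {\<one>\<^bsub>F\<^esub>}"
  shows "reduced_monoid M \<and> inside_factorial M B \<and>
    (\<forall>x\<in>B. atom M x) \<and>
    apery_set M B = carrier G \<times> {\<one>\<^bsub>F\<^esub>} \<and>
    ((\<forall>n::nat. \<forall>a\<in>carrier G. \<forall>f\<in>carrier (quotient_group F).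
        n > 0 \<longrightarrow>
        quotient_embed F (\<Otimes>\<^bsub>F\<^esub>i\<in>{1..n - 1}. I a (a [^]\<^bsub>G\<^esub> i)) \<otimes>\<^bsub>quotient_group F\<^esub>
          f [^]\<^bsub>quotient_group F\<^esub> n \<in> quotient_embed F ` carrier F \<longrightarrow>
        f \<in> quotient_embed F ` carrier F)
     \<longrightarrow> root_closed M)"
proof -
  interpret C: free_cocycle G Q I
    using G(1) I 1 2 3 unfolding F
    by (intro free_cocycle.intro symmetric_cocycle.intro symmetric_cocycle_axioms.intro
        comm_monoid_cancel_free) auto
  have twist: "I a (inv\<^bsub>G\<^esub> a) \<notin> (\<lambda>q. {#q#}) ` Q \<union> {{#}}"
    if "a \<in> carrier G" "a \<noteq> \<one>\<^bsub>G\<^esub>" for a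
    using 4 that by (simp add: F one_free)
  have reduced: "reduced_monoid M"
    unfolding M F using twist
    by (intro C.reduced_monoid_twisted Units_free) (simp add: one_free)
  moreover have "inside_factorial M B"
    using C.inside_factorial_twisted G(2) reduced by (simp add: M F B)
  moreover have "\<forall>x\<in>B. atom M x"
    using C.basis_atom twist by (simp add: M F B)
  moreover have "apery_set M B = carrier G \<times> {\<one>\<^bsub>F\<^esub>}"
    using C.apery_set_twisted by (simp add: M F B one_free)
  moreover have "root_closed M"
    if root: "\<forall>n::nat. \<forall>a\<in>carrier G. \<forall>f\<in>carrier (quotient_group F).
        n > 0 \<longrightarrow>
        quotient_embed F (\<Otimes>\<^bsub>F\<^esub>i\<in>{1..n - 1}. I a (a [^]\<^bsub>G\<^esub> i)) \<otimes>\<^bsub>quotient_group F\<^esub>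
          f [^]\<^bsub>quotient_group F\<^esub> n \<in> quotient_embed F ` carrier F \<longrightarrow>
        f \<in> quotient_embed F ` carrier F"
    unfolding M F
    by (rule C.root_closed_twisted) (rule root[unfolded F, rule_format])
  ultimately show ?thesis
    by (intro conjI impI)
qed

end
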